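(* Let $p$ be a prime, $m\ge0$ an integer, and $r,s,s'$ positive integers with $r\leq \min\{s,s',p^m\}$. (a) (Periodicity) If $s\equiv s'\pmod{p^m}$, then $\varepsilon(r,s,p)=\varepsilon(r,s',p)$. (b) (Duality) If $s'\equiv -s\pmod{p^m}$, then $\varepsilon(r,s',p)$ is the negative reverse of $\varepsilon(r,s,p)$, i.e. if $\varepsilon(r,s,p)=(\varepsilon_1,\dots,\varepsilon_r)$ then $\varepsilon(r,s',p)=(-\varepsilon_r,\dots,-\varepsilon_2,-\varepsilon_1)$.
   Context: For a positive integer $n$, let $J_n$ denote the $n\times n$ matrix with $1$s in positions $(i,i)$ for $1\le i\le n$ and $(i,i+1)$ for $1\le i<n$, and $0$s elsewhere. For $1\le r\le s$ and a field $F$ of characteristic $p$, the Jordan canonical form of $J_r\otimes J_s$ over $F$ is $J_{\lambda_1}\oplus\cdots\oplus J_{\lambda_r}$ with $\lambda_1\ge\cdots\ge\lambda_r>0$; write $\lambda(r,s,p)=(\lambda_1,\dots,\lambda_r)$ (depending only on $r,s,p$). The deviation vector is $\varepsilon(r,s,p)=(\lambda_1-s,\dots,\lambda_r-s)$. *)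

theory Defs
  imports "Jordan_Normal_Form.Jordan_Normal_Form_Uniqueness" "HOL-Number_Theory.Cong"
begin

definition kron :: "'a::semiring_1 mat \<Rightarrow> 'a mat \<Rightarrow> 'a mat" where
  "kron A B = mat (dim_row A * dim_row B) (dim_col A * dim_col B)
     (\<lambda>(i,j). A $$ (i div dim_row B, j div dim_col B) * B $$ (i mod dim_row B, j mod dim_col B))"

definition tensorJ :: "nat \<Rightarrow> nat \<Rightarrow> 'a::field mat" where
  "tensorJ r s = kron (jordan_block r 1) (jordan_block s 1)"

definition jordan_partition :: "(nat \<times> 'a) list \<Rightarrow> nat list" where
  "jordan_partition n_as = rev (sort (map fst n_as))"

definition deviation :: "nat \<Rightarrow> (nat \<times> 'a) list \<Rightarrow> int list" where
  "deviation s n_as = map (\<lambda>l. int l - int s) (jordan_partition n_as)"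

end

theory Submission
  imports Defs "HOL-Library.Function_Algebras"
begin

text \<open>
  Identify the space on which \<open>J\<^sub>r \<otimes> J\<^sub>s\<close> acts with the functions on \<open>\<nat> \<times> \<nat>\<close> supported in the
  \<open>r \<times> s\<close> box. If \<open>X\<close> and \<open>Y\<close> are the shifts in the two coordinates, then \<open>J\<^sub>r \<otimes> J\<^sub>s - 1\<close> is the
  operator \<open>Z = X + Y + X Y\<close>, that is, \<open>1 + Z = (1 + X) (1 + Y)\<close>. In characteristic \<open>p\<close>, raising
  this to the power \<open>q = p ^ m \<ge> r\<close> gives \<open>Z ^ q = Y ^ q\<close> on the kernel \<open>K\<close> of \<open>X ^ r\<close>. As \<open>Y\<close> is
  surjective on \<open>K\<close>, so is \<open>Z\<close>, and the kernel of \<open>Z ^ n\<close> on \<open>K\<close> has dimension \<open>r n\<close>.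

  Let \<open>D s k\<close> be the dimension of the kernel of \<open>Z ^ k\<close> on the box, which is the sum of \<open>min k l\<close> over
  the Jordan block sizes \<open>l\<close>. If \<open>q\<close> divides \<open>d\<close>, then \<open>Z ^ d = Y ^ d\<close> maps the kernel for
  \<open>(s + d, k + d)\<close> onto the one for \<open>(s, k)\<close>, so \<open>D (s + d) (k + d) = r d + D s k\<close>. If \<open>q\<close> divides
  \<open>Q = s + s'\<close>, then the image of the \<open>r \<times> s'\<close> box under \<open>Z ^ k\<close> equals the image of the kernel of
  \<open>Z ^ (Q - k)\<close> on \<open>K\<close> under \<open>Y ^ s\<close>, whence \<open>r s' - D s' k = r (Q - k) - D s (Q - k)\<close>.
  These identities say that the block sizes become \<open>l + d\<close> and \<open>Q - l\<close>, respectively.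
\<close>

subsection \<open>Subspaces of function spaces\<close>

definition fun_subspace :: "('b \<Rightarrow> 'a::field) set \<Rightarrow> bool" where
  "fun_subspace S \<longleftrightarrow> 0 \<in> S \<and> (\<forall>f\<in>S. \<forall>g\<in>S. f + g \<in> S) \<and> (\<forall>c. \<forall>f\<in>S. (\<lambda>b. c * f b) \<in> S)"

definition fun_vs :: "('b \<Rightarrow> 'a::field) set \<Rightarrow> ('a, 'b \<Rightarrow> 'a) module" where
  "fun_vs S = \<lparr>carrier = S, mult = undefined, one = undefined, zero = 0, add = (+),
     smult = (\<lambda>c f b. c * f b)\<rparr>"

abbreviation fun_fin_dim :: "('b \<Rightarrow> 'a::field) set \<Rightarrow> bool" where
  "fun_fin_dim S \<equiv> vectorspace.fin_dim class_ring (fun_vs S)"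

abbreviation fun_dim :: "('b \<Rightarrow> 'a::field) set \<Rightarrow> nat" where
  "fun_dim S \<equiv> vectorspace.dim class_ring (fun_vs S)"

definition linear_op :: "(('b \<Rightarrow> 'a::field) \<Rightarrow> ('c \<Rightarrow> 'a)) \<Rightarrow> bool" where
  "linear_op N \<longleftrightarrow> (\<forall>f g. N (f + g) = N f + N g) \<and> (\<forall>c f. N (\<lambda>b. c * f b) = (\<lambda>b. c * N f b))"

lemma fun_vs_simps [simp]:
  "carrier (fun_vs S) = S" "zero (fun_vs S) = 0" "add (fun_vs S) = (+)"
  "module.smult (fun_vs S) = (\<lambda>c f b. c * f b)"
  by (simp_all add: fun_vs_def)

text \<open>Kernel and image of a linear map come as carrier updates of the ambient space; this
  rewrites them as spaces of the form \<open>fun_vs\<close>.\<close>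

lemma fun_vs_carrier_update [simp]: "fun_vs S\<lparr>carrier := S'\<rparr> = fun_vs S'"
  by (simp add: fun_vs_def)

lemma linear_op_add: "linear_op N \<Longrightarrow> N (f + g) = N f + N g"
  and linear_op_scale: "linear_op N \<Longrightarrow> N (\<lambda>b. c * f b) = (\<lambda>b. c * N f b)"
  by (simp_all add: linear_op_def)

lemma linear_op_zero [simp]: "linear_op N \<Longrightarrow> N 0 = 0"
  using linear_op_scale[of N 0 "\<lambda>_. 0"] by (simp add: zero_fun_def)

lemma linear_op_funpow:
  fixes N :: "('b \<Rightarrow> 'a::field) \<Rightarrow> ('b \<Rightarrow> 'a)"
  shows "linear_op N \<Longrightarrow> linear_op (N ^^ k)"
  by (induction k) (simp_all add: linear_op_def)

lemma linear_op_funpow_eq_0_mono: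
  fixes N :: "('b \<Rightarrow> 'a::field) \<Rightarrow> ('b \<Rightarrow> 'a)"
  assumes "linear_op N" "(N ^^ k) f = 0" "k \<le> n"
  shows "(N ^^ n) f = 0"
proof -
  have "(N ^^ n) f = (N ^^ (n - k)) ((N ^^ k) f)"
    using assms(3) by (metis comp_apply funpow_add le_add_diff_inverse2)
  then show ?thesis
    unfolding assms(2) linear_op_zero[OF linear_op_funpow[OF assms(1)]] .
qed

lemma fun_subspace_ker: "fun_subspace S \<Longrightarrow> linear_op N \<Longrightarrow> fun_subspace {f \<in> S. N f = 0}"
  by (simp add: fun_subspace_def linear_op_add linear_op_scale) (simp add: zero_fun_def)

lemma fun_subspace_image:
  assumes "fun_subspace S" "linear_op N"
  shows "fun_subspace (N ` S)"
  unfolding fun_subspace_def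
proof (intro conjI ballI allI)
  show "0 \<in> N ` S"
    using assms by (metis fun_subspace_def image_eqI linear_op_zero)
next
  fix f g assume "f \<in> N ` S" "g \<in> N ` S"
  then show "f + g \<in> N ` S"
    using assms by (auto simp: fun_subspace_def linear_op_add[symmetric])
next
  fix c f assume "f \<in> N ` S"
  then show "(\<lambda>b. c * f b) \<in> N ` S"
    using assms by (auto simp: fun_subspace_def linear_op_scale[symmetric])
qed

lemma vectorspace_fun_vs:
  fixes S :: "('b \<Rightarrow> 'a::field) set"
  assumes "fun_subspace S"
  shows "vectorspace (class_ring :: 'a ring) (fun_vs S)"
proof (rule vs_criteria)
  show "field (class_ring :: 'a ring)"
    by (rule class_field)
  show "\<forall>v\<in>carrier (fun_vs S). \<exists>w\<in>carrier (fun_vs S). v \<oplus>\<^bsub>fun_vs S\<^esub> w = \<zero>\<^bsub>fun_vs S\<^esub>"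
  proof
    fix v assume "v \<in> carrier (fun_vs S)"
    then have "(\<lambda>b. - 1 * v b) \<in> S"
      using assms unfolding fun_subspace_def fun_vs_simps by blast
    then show "\<exists>w\<in>carrier (fun_vs S). v \<oplus>\<^bsub>fun_vs S\<^esub> w = \<zero>\<^bsub>fun_vs S\<^esub>"
      by (intro bexI[of _ "\<lambda>b. - 1 * v b"]) (simp_all add: fun_eq_iff)
  qed
qed (use assms in \<open>auto simp: fun_subspace_def fun_eq_iff algebra_simps\<close>)

lemma linear_map_fun_vs:
  fixes N :: "('b \<Rightarrow> 'a::field) \<Rightarrow> ('c \<Rightarrow> 'a)"
  assumes "fun_subspace S" "linear_op N"
  shows "linear_map (class_ring :: 'a ring) (fun_vs S) (fun_vs (N ` S)) N"
proof -
  interpret V: vectorspace "class_ring :: 'a ring" "fun_vs S"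
    by (rule vectorspace_fun_vs[OF assms(1)])
  interpret W: vectorspace "class_ring :: 'a ring" "fun_vs (N ` S)"
    by (rule vectorspace_fun_vs[OF fun_subspace_image[OF assms]])
  show ?thesis
    by unfold_locales (use assms in \<open>auto simp: module_hom_def linear_op_add linear_op_scale\<close>)
qed

lemma fun_rank_nullity:
  assumes "fun_subspace S" "linear_op N" "fun_fin_dim S"
  shows "fun_dim (N ` S) + fun_dim {f \<in> S. N f = 0} = fun_dim S"
proof -
  interpret linear_map class_ring "fun_vs S" "fun_vs (N ` S)" N
    by (rule linear_map_fun_vs[OF assms(1,2)])
  show ?thesis
    using rank_nullity[OF assms(3)] by (simp add: im_def ker_def)
qed

text \<open>Left multiplication by the invertible \<open>P\<close> keeps the kernel, and the base
  vectors read off from the row echelon form are a finite basis of it.\<close>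

lemma (in kernel) kernel_fin_dim: "Ker.fin_dim"
proof -
  let ?B = "gauss_jordan_single A"
  from gauss_jordan_single[OF A refl]
  obtain P Q where AB: "?B = P * A" and QP: "Q * P = 1\<^sub>m nr" and
    P: "P \<in> carrier_mat nr nr" and Q: "Q \<in> carrier_mat nr nr" and B: "?B \<in> carrier_mat nr nc"
    and row: "row_echelon_form ?B" by auto
  have "mat_kernel ?B = mat_kernel A"
    using mat_kernel_mult_eq[OF A P Q QP, folded AB] .
  then have "basis (set (find_base_vectors ?B))"
    using find_base_vectors(3)[OF row B] by simp
  then show ?thesis
    unfolding Ker.fin_dim_def Ker.basis_def by blast
qed

lemma fun_dim_mat_kernel:
  fixes A :: "'a::field mat" and \<phi> :: "'a vec \<Rightarrow> ('b \<Rightarrow> 'a)"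
  assumes A: "A \<in> carrier_mat n n" and S: "fun_subspace S"
    and add: "\<And>u v. u \<in> carrier_vec n \<Longrightarrow> v \<in> carrier_vec n \<Longrightarrow> \<phi> (u + v) = \<phi> u + \<phi> v"
    and smult: "\<And>c v. v \<in> carrier_vec n \<Longrightarrow> \<phi> (c \<cdot>\<^sub>v v) = (\<lambda>b. c * \<phi> v b)"
    and bij: "bij_betw \<phi> (mat_kernel A) S"
  shows "fun_fin_dim S" "fun_dim S = kernel_dim A"
proof -
  interpret K: kernel n n A by unfold_locales (rule A)
  interpret W: vectorspace "class_ring :: 'a ring" "fun_vs S"
    by (rule vectorspace_fun_vs[OF S])
  have sub: "mat_kernel A \<subseteq> carrier_vec n"
    by (rule mat_kernel_carrier[OF A])
  interpret L: linear_map "class_ring :: 'a ring" K.VK "fun_vs S" \<phi>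
    by unfold_locales
      (use sub bij add smult in \<open>auto simp: module_hom_def bij_betw_def module_vec_simps subset_iff\<close>)
  have inj: "inj_on \<phi> (carrier K.VK)" and surj: "\<phi> ` carrier K.VK = carrier (fun_vs S)"
    using bij by (auto simp: bij_betw_def)
  show "fun_fin_dim S"
    using L.surj_fin_dim[OF K.kernel_fin_dim surj] .
  show "fun_dim S = kernel_dim A"
    using L.dim_eq[OF K.kernel_fin_dim inj surj] by simp
qed

subsection \<open>Shift operators in prime characteristic\<close>

definition plus_id :: "(('b \<Rightarrow> 'a::field) \<Rightarrow> ('b \<Rightarrow> 'a)) \<Rightarrow> ('b \<Rightarrow> 'a) \<Rightarrow> ('b \<Rightarrow> 'a)" where
  "plus_id N f = f + N f"

text \<open>The binomial theorem for \<open>1 + N\<close>, evaluated at a point so that the binomial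
  coefficients become scalars of the field. The induction is Pascal's rule.\<close>

lemma plus_id_funpow:
  fixes N :: "('b \<Rightarrow> 'a::field) \<Rightarrow> ('b \<Rightarrow> 'a)"
  assumes "linear_op N"
  shows "(plus_id N ^^ n) f b = (\<Sum>j\<le>n. of_nat (n choose j) * (N ^^ j) f b)"
proof (induction n arbitrary: f)
  case 0
  then show ?case by simp
next
  case (Suc n)
  have "(plus_id N ^^ Suc n) f b = (plus_id N ^^ n) (f + N f) b"
    by (simp add: funpow_swap1[symmetric] funpow_Suc_right plus_id_def del: funpow.simps)
  also have "\<dots> = (\<Sum>j\<le>n. of_nat (n choose j) * (N ^^ j) (f + N f) b)"
    by (rule Suc.IH)
  also have "\<dots> = (\<Sum>j\<le>n. of_nat (n choose j) * (N ^^ j) f b)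
      + (\<Sum>j\<le>n. of_nat (n choose j) * (N ^^ Suc j) f b)"
    by (simp add: linear_op_add[OF linear_op_funpow[OF assms]] funpow_swap1 algebra_simps
        sum.distrib)
  also have "(\<Sum>j\<le>n. of_nat (n choose j) * (N ^^ j) f b)
      = f b + (\<Sum>j\<le>n. of_nat (n choose Suc j) * (N ^^ Suc j) f b)"
  proof -
    \<comment> \<open>Adding the term \<open>j = Suc n\<close>, whose coefficient is 0, lets the
      index be shifted and the term \<open>j = 0\<close> be split off.\<close>
    have "(\<Sum>j\<le>n. of_nat (n choose j) * (N ^^ j) f b)
        = (\<Sum>j\<le>Suc n. of_nat (n choose j) * (N ^^ j) f b)"
      by (simp add: binomial_eq_0)
    then show ?thesis
      by (simp add: sum.atMost_Suc_shift del: sum.atMost_Suc)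
  qed
  also have "f b + (\<Sum>j\<le>n. of_nat (n choose Suc j) * (N ^^ Suc j) f b)
      + (\<Sum>j\<le>n. of_nat (n choose j) * (N ^^ Suc j) f b)
      = (\<Sum>j\<le>Suc n. of_nat (Suc n choose j) * (N ^^ j) f b)"
    by (subst sum.atMost_Suc_shift) (simp add: sum.distrib algebra_simps del: funpow.simps)
  finally show ?case .
qed

text \<open>\<open>p\<close> divides \<open>p choose j\<close> for \<open>0 < j < p\<close>, so only
  the two end terms of the binomial sum survive.\<close>

lemma plus_id_funpow_prime:
  fixes N :: "('b \<Rightarrow> 'a::field) \<Rightarrow> ('b \<Rightarrow> 'a)"
  assumes "linear_op N" "prime p" "CHAR('a) = p"
  shows "plus_id N ^^ p = plus_id (N ^^ p)"
proof (intro ext)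
  fix f b
  have p: "p > 0" using assms(2) by (rule prime_gt_0_nat)
  have "(plus_id N ^^ p) f b = (\<Sum>j\<in>{0, p}. of_nat (p choose j) * (N ^^ j) f b)"
    unfolding plus_id_funpow[OF assms(1)]
  proof (intro sum.mono_neutral_right ballI)
    fix j assume "j \<in> {..p} - {0, p}"
    then have "p dvd (p choose j)"
      using dvd_choose_prime[of j p] assms(2) by auto
    then have "of_nat (p choose j) = (0 :: 'a)"
      using assms(3) of_nat_eq_0_iff_char_dvd by blast
    then show "of_nat (p choose j) * (N ^^ j) f b = 0" by simp
  qed auto
  then show "(plus_id N ^^ p) f b = plus_id (N ^^ p) f b"
    using p by (simp add: plus_id_def)
qed

lemma plus_id_funpow_prime_power:
  fixes N :: "('b \<Rightarrow> 'a::field) \<Rightarrow> ('b \<Rightarrow> 'a)"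
  assumes "linear_op N" "prime p" "CHAR('a) = p"
  shows "plus_id N ^^ (p ^ m) = plus_id (N ^^ (p ^ m))"
proof (induction m)
  case 0
  then show ?case by simp
next
  case (Suc m)
  have "plus_id N ^^ (p ^ Suc m) = (plus_id N ^^ (p ^ m)) ^^ p"
    by (simp add: funpow_mult mult.commute)
  also have "\<dots> = plus_id ((N ^^ (p ^ m)) ^^ p)"
    unfolding Suc.IH by (rule plus_id_funpow_prime[OF linear_op_funpow[OF assms(1)] assms(2,3)])
  finally show ?case
    by (simp add: funpow_mult mult.commute)
qed

section \<open>Coordinate shifts on functions on pairs of naturals\<close>

definition shift_fst :: "(nat \<times> nat \<Rightarrow> 'a) \<Rightarrow> nat \<times> nat \<Rightarrow> 'a" where
  "shift_fst f = (\<lambda>(i, j). f (Suc i, j))"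

definition shift_snd :: "(nat \<times> nat \<Rightarrow> 'a) \<Rightarrow> nat \<times> nat \<Rightarrow> 'a" where
  "shift_snd f = (\<lambda>(i, j). f (i, Suc j))"

text \<open>A superdiagonal 1 makes coordinate \<open>i\<close> read coordinate
  \<open>i + 1\<close>, so the nilpotent part of a Jordan block is a shift. Functions vanish outside
  the box, which takes care of the last row.\<close>

definition tensor_shift :: "(nat \<times> nat \<Rightarrow> 'a::field) \<Rightarrow> nat \<times> nat \<Rightarrow> 'a" where
  "tensor_shift f = shift_fst f + shift_snd f + shift_fst (shift_snd f)"

lemma shift_fst_funpow: "(shift_fst ^^ n) f = (\<lambda>(i, j). f (i + n, j))"
  by (induction n) (auto simp: shift_fst_def)

lemma shift_snd_funpow: "(shift_snd ^^ n) f = (\<lambda>(i, j). f (i, j + n))"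
  by (induction n) (auto simp: shift_snd_def)

lemma tensor_shift_apply: "tensor_shift f (i, j) = f (Suc i, j) + f (i, Suc j) + f (Suc i, Suc j)"
  by (simp add: tensor_shift_def shift_fst_def shift_snd_def)

lemma linear_op_shift_fst: "linear_op shift_fst"
  and linear_op_shift_snd: "linear_op shift_snd"
  and linear_op_tensor_shift: "linear_op tensor_shift"
  by (auto simp: linear_op_def tensor_shift_def shift_fst_def shift_snd_def fun_eq_iff algebra_simps)

lemmas shift_snd_funpow_eq_0_mono = linear_op_funpow_eq_0_mono[OF linear_op_shift_snd]

lemmas tensor_shift_funpow_eq_0_mono = linear_op_funpow_eq_0_mono[OF linear_op_tensor_shift]

lemma funpow_commute_funpow:
  fixes F G :: "'b \<Rightarrow> 'b"
  assumes "\<And>x. F (G x) = G (F x)"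
  shows "(F ^^ m) ((G ^^ n) x) = (G ^^ n) ((F ^^ m) x)"
proof -
  have "F ((G ^^ n) x) = (G ^^ n) (F x)" for x
    by (induction n) (simp_all add: assms)
  then show ?thesis
    by (induction m) simp_all
qed

lemma funpow_comp_commute:
  fixes F G H :: "'b \<Rightarrow> 'b"
  assumes "\<And>x. F (G x) = G (F x)" and "\<And>x. H x = F (G x)"
  shows "(H ^^ n) x = (F ^^ n) ((G ^^ n) x)"
proof (induction n)
  case (Suc n)
  have "G ((F ^^ n) ((G ^^ n) x)) = (F ^^ n) (G ((G ^^ n) x))"
    using funpow_commute_funpow[of F G n 1] assms(1) by simp
  then show ?case
    by (simp add: Suc.IH assms(2)[of "(F ^^ n) ((G ^^ n) x)"])
qed simp

text \<open>Raising \<open>1 + Z = (1 + X) (1 + Y)\<close> to the power \<open>q\<close> replaces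
  each operator by its \<open>q\<close>-th power; then \<open>f\<close> cancels.\<close>

lemma tensor_shift_funpow_prime_power:
  fixes f :: "nat \<times> nat \<Rightarrow> 'a::field"
  assumes "prime p" "CHAR('a) = p" "q = p ^ m"
  shows "(tensor_shift ^^ q) f (i, j) = f (i + q, j) + f (i, j + q) + f (i + q, j + q)"
proof -
  note P = plus_id_funpow_prime_power[OF _ assms(1,2), of _ m, folded assms(3)]
  let ?X = "shift_fst :: (nat \<times> nat \<Rightarrow> 'a) \<Rightarrow> _" and ?Y = "shift_snd :: (nat \<times> nat \<Rightarrow> 'a) \<Rightarrow> _"
  have "(plus_id tensor_shift ^^ q) f = (plus_id ?X ^^ q) ((plus_id ?Y ^^ q) f)"
    by (rule funpow_comp_commute)
      (auto simp: fun_eq_iff plus_id_def tensor_shift_def shift_fst_def shift_snd_def)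
  then have "plus_id (tensor_shift ^^ q) f (i, j) = plus_id (?X ^^ q) (plus_id (?Y ^^ q) f) (i, j)"
    by (simp add: P linear_op_shift_fst linear_op_shift_snd linear_op_tensor_shift)
  then show ?thesis
    by (simp add: plus_id_def shift_fst_funpow shift_snd_funpow add_ac)
qed

lemma tensor_shift_commute: "tensor_shift (shift_snd f) = shift_snd (tensor_shift f)"
  by (auto simp: fun_eq_iff tensor_shift_apply shift_snd_def)

lemma tensor_shift_funpow_commute:
  "(tensor_shift ^^ m) ((shift_snd ^^ n) f) = (shift_snd ^^ n) ((tensor_shift ^^ m) f)"
  by (rule funpow_commute_funpow) (rule tensor_shift_commute)

text \<open>The kernel of \<open>X ^ r\<close>. Leaving the second coordinate unbounded gives room
  for preimages: \<open>Y\<close> and \<open>Z\<close> become surjective here, as they cannot be on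
  a nonzero finite box.\<close>

definition strip :: "nat \<Rightarrow> (nat \<times> nat \<Rightarrow> 'a::field) set" where
  "strip r = {f. \<forall>i j. r \<le> i \<longrightarrow> f (i, j) = 0}"

definition box :: "nat \<Rightarrow> nat \<Rightarrow> (nat \<times> nat \<Rightarrow> 'a::field) set" where
  "box r s = {f \<in> strip r. (shift_snd ^^ s) f = 0}"

definition box_ker :: "nat \<Rightarrow> nat \<Rightarrow> nat \<Rightarrow> (nat \<times> nat \<Rightarrow> 'a::field) set" where
  "box_ker r s k = {f \<in> box r s. (tensor_shift ^^ k) f = 0}"

definition strip_ker :: "nat \<Rightarrow> nat \<Rightarrow> (nat \<times> nat \<Rightarrow> 'a::field) set" where
  "strip_ker r k = {f \<in> strip r. (tensor_shift ^^ k) f = 0}"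

lemma box_iff: "f \<in> box r s \<longleftrightarrow> (\<forall>i j. \<not> (i < r \<and> j < s) \<longrightarrow> f (i, j) = 0)"
proof
  assume f: "f \<in> box r s"
  then have "f (i, j + s) = 0" for i j
    by (simp add: box_def shift_snd_funpow fun_eq_iff)
  then have "s \<le> j \<Longrightarrow> f (i, j) = 0" for i j
    by (metis le_add_diff_inverse2)
  then show "\<forall>i j. \<not> (i < r \<and> j < s) \<longrightarrow> f (i, j) = 0"
    using f by (auto simp: box_def strip_def)
qed (auto simp: box_def strip_def shift_snd_funpow fun_eq_iff)

lemma fun_subspace_strip: "fun_subspace (strip r)"
  by (auto simp: fun_subspace_def strip_def)

lemma fun_subspace_box: "fun_subspace (box r s)"
  unfolding box_def
  by (intro fun_subspace_ker fun_subspace_strip linear_op_funpow linear_op_shift_snd)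

lemma fun_subspace_box_ker: "fun_subspace (box_ker r s k)"
  unfolding box_ker_def
  by (intro fun_subspace_ker fun_subspace_box linear_op_funpow linear_op_tensor_shift)

lemma fun_subspace_strip_ker: "fun_subspace (strip_ker r k)"
  unfolding strip_ker_def
  by (intro fun_subspace_ker fun_subspace_strip linear_op_funpow linear_op_tensor_shift)

lemma strip_shift_snd: "f \<in> strip r \<Longrightarrow> (shift_snd ^^ n) f \<in> strip r"
  by (simp add: strip_def shift_snd_funpow)

lemma strip_tensor_shift: "f \<in> strip r \<Longrightarrow> (tensor_shift ^^ n) f \<in> strip r"
  by (induction n) (auto simp: strip_def tensor_shift_apply)

lemma shift_snd_surj_strip: "g \<in> strip r \<Longrightarrow> \<exists>f\<in>strip r. (shift_snd ^^ n) f = g"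
  by (intro bexI[of _ "\<lambda>(i, j). if n \<le> j then g (i, j - n) else 0"])
    (auto simp: strip_def shift_snd_funpow)

subsection \<open>Generalized eigenspaces of the tensor product\<close>

text \<open>Row-major indexing, matching \<open>kron\<close>, where the index \<open>c\<close>
  stands for the pair \<open>(c div s, c mod s)\<close>.\<close>

definition vec_fun :: "nat \<Rightarrow> nat \<Rightarrow> 'a::field vec \<Rightarrow> nat \<times> nat \<Rightarrow> 'a" where
  "vec_fun r s v = (\<lambda>(i, j). if i < r \<and> j < s then v $ (i * s + j) else 0)"

lemma mult_add_less:
  assumes "i < r" "j < s"
  shows "i * s + j < r * (s::nat)"
proof -
  have "i * s + j < Suc i * s" using assms by simp
  also have "\<dots> \<le> r * s" using assms by (intro mult_le_mono1) simp
  finally show ?thesis .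
qed

lemma vec_fun_add: "u \<in> carrier_vec (r * s) \<Longrightarrow> v \<in> carrier_vec (r * s) \<Longrightarrow>
    vec_fun r s (u + v) = vec_fun r s u + vec_fun r s v"
  by (auto simp: vec_fun_def fun_eq_iff mult_add_less)

lemma vec_fun_smult: "v \<in> carrier_vec (r * s) \<Longrightarrow>
    vec_fun r s (c \<cdot>\<^sub>v v) = (\<lambda>b. c * vec_fun r s v b)"
  by (auto simp: vec_fun_def fun_eq_iff mult_add_less)

lemma vec_fun_bij: "bij_betw (vec_fun r s) (carrier_vec (r * s)) (box r s)"
proof (rule bij_betw_byWitness[where f' = "\<lambda>f. vec (r * s) (\<lambda>c. f (c div s, c mod s))"])
  have less: "c div s < r \<and> c mod s < s" if "c < r * s" for c
    using that by (metis less_mult_imp_div_less mod_less_divisor mult_0_right not_less_zero gr0I)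
  show "\<forall>v\<in>carrier_vec (r * s). vec (r * s) (\<lambda>c. vec_fun r s v (c div s, c mod s)) = v"
    by (auto simp: vec_fun_def less intro!: eq_vecI)
  show "\<forall>f\<in>box r s. vec_fun r s (vec (r * s) (\<lambda>c. f (c div s, c mod s))) = f"
    by (auto simp: vec_fun_def box_iff fun_eq_iff mult_add_less)
  show "vec_fun r s ` carrier_vec (r * s) \<subseteq> box r s"
    by (auto simp: vec_fun_def box_iff)
qed auto

lemma vec_fun_eq_0_iff: "v \<in> carrier_vec (r * s) \<Longrightarrow> vec_fun r s v = 0 \<longleftrightarrow> v = 0\<^sub>v (r * s)"
proof -
  assume v: "v \<in> carrier_vec (r * s)"
  have "vec_fun r s (0\<^sub>v (r * s)) = (0 :: nat \<times> nat \<Rightarrow> 'a)"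
    by (auto simp: vec_fun_def fun_eq_iff mult_add_less)
  then show ?thesis
    using bij_betw_imp_inj_on[OF vec_fun_bij, THEN inj_onD, of r s v "0\<^sub>v (r * s)"] v by auto
qed

lemma tensorJ_carrier: "tensorJ r s \<in> carrier_mat (r * s) (r * s)"
  by (simp add: tensorJ_def kron_def)

lemma sum_jordan_block_row:
  fixes g :: "nat \<Rightarrow> 'a::field"
  assumes "i < n"
  shows "(\<Sum>l<n. jordan_block n 1 $$ (i, l) * g l) = g i + (if Suc i < n then g (Suc i) else 0)"
proof -
  have "(\<Sum>l<n. jordan_block n 1 $$ (i, l) * g l)
      = (\<Sum>l<n. (if l = i then g l else 0) + (if l = Suc i then g l else 0))"
    using assms by (intro sum.cong) auto
  also have "\<dots> = g i + (if Suc i < n then g (Suc i) else 0)"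
    using assms by (simp add: sum.distrib)
  finally show ?thesis .
qed

lemma vec_fun_tensorJ:
  fixes v :: "'a::field vec"
  assumes v: "v \<in> carrier_vec (r * s)"
  shows "vec_fun r s (char_matrix (tensorJ r s) 1 *\<^sub>v v) = tensor_shift (vec_fun r s v)"
proof (intro ext, clarify)
  fix i j
  let ?A = "tensorJ r s :: 'a mat" and ?f = "vec_fun r s v"
  have A: "?A \<in> carrier_mat (r * s) (r * s)" by (rule tensorJ_carrier)
  show "vec_fun r s (char_matrix ?A 1 *\<^sub>v v) (i, j) = tensor_shift ?f (i, j)"
  proof (cases "i < r \<and> j < s")
    case True
    then have lt: "i * s + j < r * s" by (simp add: mult_add_less)
    have "char_matrix ?A 1 *\<^sub>v v = ?A *\<^sub>v v - v"
      unfolding char_matrix_def using A v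
      by (intro eq_vecI) (auto simp: add_scalar_prod_distrib[of _ "r * s"])
    then have "vec_fun r s (char_matrix ?A 1 *\<^sub>v v) (i, j) = (?A *\<^sub>v v) $ (i * s + j) - ?f (i, j)"
      using True lt v by (simp add: vec_fun_def)
    also have "(?A *\<^sub>v v) $ (i * s + j) = (\<Sum>c<r * s. ?A $$ (i * s + j, c) * v $ c)"
      using A v lt by (simp add: scalar_prod_def lessThan_atLeast0)
    \<comment> \<open>The column index is split into \<open>r\<close> groups of length
      \<open>s\<close>, so that each entry factors into one entry per Jordan block.\<close>
    also have "\<dots> = (\<Sum>k<r. \<Sum>l<s. ?A $$ (i * s + j, k * s + l) * v $ (k * s + l))"
    proof -
      let ?g = "\<lambda>c. ?A $$ (i * s + j, c) * v $ c"
      have "sum ?g {k * s..<k * s + s} = (\<Sum>l<s. ?g (k * s + l))" for k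
        using sum.shift_bounds_nat_ivl[of ?g 0 "k * s" s]
        by (simp add: lessThan_atLeast0 add.commute)
      then show ?thesis
        using sum.nat_group[of ?g s r] by simp
    qed
    also have "\<dots> = (\<Sum>k<r. jordan_block r 1 $$ (i, k) * (\<Sum>l<s. jordan_block s 1 $$ (j, l) * ?f (k, l)))"
    proof -
      have "?A $$ (i * s + j, k * s + l) * v $ (k * s + l)
          = jordan_block r 1 $$ (i, k) * (jordan_block s 1 $$ (j, l) * ?f (k, l))"
        if "k < r" "l < s" for k l
        using True that lt mult_add_less[OF that]
        by (simp add: tensorJ_def kron_def vec_fun_def del: jordan_block_index(1))
      then show ?thesis
        by (simp add: sum_distrib_left del: jordan_block_index(1))
    qed
    also have "\<dots> = ?f (i, j) + ?f (i, Suc j) + (?f (Suc i, j) + ?f (Suc i, Suc j))"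
      using True by (simp add: sum_jordan_block_row del: jordan_block_index(1)) (simp add: vec_fun_def)
    finally show ?thesis
      by (simp add: tensor_shift_apply)
  qed (auto simp: vec_fun_def tensor_shift_apply)
qed

lemma vec_fun_tensorJ_pow:
  fixes v :: "'a::field vec"
  assumes "v \<in> carrier_vec (r * s)"
  shows "vec_fun r s (char_matrix (tensorJ r s) 1 ^\<^sub>m k *\<^sub>v v) = (tensor_shift ^^ k) (vec_fun r s v)"
  using assms
proof (induction k arbitrary: v)
  case 0
  then show ?case
    using char_matrix_closed[OF tensorJ_carrier[of r s], of "1 :: 'a"] by simp
next
  case (Suc k)
  let ?M = "char_matrix (tensorJ r s) 1"
  have M: "?M \<in> carrier_mat (r * s) (r * s)"
    by (intro char_matrix_closed tensorJ_carrier)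
  have "?M ^\<^sub>m Suc k *\<^sub>v v = ?M ^\<^sub>m k *\<^sub>v (?M *\<^sub>v v)"
    using assoc_mult_mat_vec[OF pow_carrier_mat[OF M] M Suc.prems] by simp
  then show ?case
    using Suc.IH[of "?M *\<^sub>v v"] mult_mat_vec_carrier[OF M Suc.prems] Suc.prems
    by (simp add: vec_fun_tensorJ funpow_swap1)
qed

text \<open>The bridge to matrices: \<open>vec_fun\<close> turns \<open>tensorJ r s - 1\<close> into
  \<open>Z\<close>, hence the kernels of their powers correspond.\<close>

lemma box_ker_dim:
  shows "fun_fin_dim (box_ker r s k :: (nat \<times> nat \<Rightarrow> 'a::field) set)"
    and "fun_dim (box_ker r s k :: (nat \<times> nat \<Rightarrow> 'a::field) set)
           = dim_gen_eigenspace (tensorJ r s :: 'a mat) 1 k"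
proof -
  let ?M = "char_matrix (tensorJ r s) 1 ^\<^sub>m k :: 'a mat"
  have M: "?M \<in> carrier_mat (r * s) (r * s)"
    by (intro pow_carrier_mat char_matrix_closed tensorJ_carrier)
  have "?M *\<^sub>v v = 0\<^sub>v (r * s) \<longleftrightarrow> (tensor_shift ^^ k) (vec_fun r s v) = 0"
    if "v \<in> carrier_vec (r * s)" for v
    using M that vec_fun_eq_0_iff[of "?M *\<^sub>v v" r s] by (simp add: vec_fun_tensorJ_pow)
  then have eq: "v \<in> mat_kernel ?M \<longleftrightarrow> v \<in> carrier_vec (r * s) \<and> vec_fun r s v \<in> box_ker r s k" for v
    using bij_betwE[OF vec_fun_bij, of r s] by (auto simp: mat_kernel[OF M] box_ker_def)
  have "vec_fun r s ` mat_kernel ?M = box_ker r s k"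
  proof (intro equalityI subsetI)
    fix f :: "nat \<times> nat \<Rightarrow> 'a"
    assume f: "f \<in> box_ker r s k"
    then have "f \<in> vec_fun r s ` carrier_vec (r * s)"
      using bij_betw_imp_surj_on[OF vec_fun_bij[where 'a = 'a], of r s] by (simp add: box_ker_def)
    then show "f \<in> vec_fun r s ` mat_kernel ?M"
      using f eq by blast
  qed (use eq in blast)
  then have "bij_betw (vec_fun r s) (mat_kernel ?M) (box_ker r s k)"
    using inj_on_subset[OF bij_betw_imp_inj_on[OF vec_fun_bij] mat_kernel_carrier[OF M]]
    by (simp add: bij_betw_def)
  note * = fun_dim_mat_kernel[OF M fun_subspace_box_ker _ _ this]
  show "fun_fin_dim (box_ker r s k :: (nat \<times> nat \<Rightarrow> 'a::field) set)"
    by (rule *(1)) (auto simp: vec_fun_add vec_fun_smult)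
  show "fun_dim (box_ker r s k :: (nat \<times> nat \<Rightarrow> 'a::field) set)
      = dim_gen_eigenspace (tensorJ r s :: 'a mat) 1 k"
    unfolding dim_gen_eigenspace_def by (rule *(2)) (auto simp: vec_fun_add vec_fun_smult)
qed

text \<open>The box corresponds to the kernel of the zero matrix, so the same transport of
  dimensions applies.\<close>

lemma box_dim:
  shows "fun_fin_dim (box r s :: (nat \<times> nat \<Rightarrow> 'a::field) set)"
    and "fun_dim (box r s :: (nat \<times> nat \<Rightarrow> 'a::field) set) = r * s"
proof -
  let ?M = "0\<^sub>m (r * s) (r * s) :: 'a mat"
  interpret K: kernel "r * s" "r * s" ?M by unfold_locales simp
  have ker: "mat_kernel ?M = carrier_vec (r * s)"
    by (auto simp: mat_kernel_def)
  then have "bij_betw (vec_fun r s) (mat_kernel ?M) (box r s)"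
    by (simp add: vec_fun_bij)
  note * = fun_dim_mat_kernel[OF zero_carrier_mat fun_subspace_box _ _ this]
  show "fun_fin_dim (box r s :: (nat \<times> nat \<Rightarrow> 'a::field) set)"
    by (rule *(1)) (auto simp: vec_fun_add vec_fun_smult)
  have "fun_dim (box r s :: (nat \<times> nat \<Rightarrow> 'a::field) set) = kernel_dim ?M"
    by (rule *(2)) (auto simp: vec_fun_add vec_fun_smult)
  also have "\<dots> = r * s"
    using K.NC.dim_is_n ker by (simp add: module_vec_def)
  finally show "fun_dim (box r s :: (nat \<times> nat \<Rightarrow> 'a::field) set) = r * s" .
qed

subsection \<open>Dimensions of the kernels\<close>

locale prime_char_strip =
  fixes ty :: "'a::field itself" and p m r q :: nat
  assumes prime: "prime p" and char: "CHAR('a) = p" and q: "q = p ^ m" and r_le_q: "r \<le> q"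
begin

lemma q_pos: "0 < q"
  using prime by (simp add: q prime_gt_0_nat)

text \<open>Since \<open>r \<le> q\<close>, the terms of \<open>Z ^ q\<close> that contain
  \<open>X ^ q\<close> vanish on the strip. Multiples of \<open>q\<close> follow because
  \<open>Y\<close> preserves the strip.\<close>

lemma tensor_shift_funpow_strip:
  fixes f :: "nat \<times> nat \<Rightarrow> 'a"
  assumes "f \<in> strip r" "q dvd n"
  shows "(tensor_shift ^^ n) f = (shift_snd ^^ n) f"
proof -
  have base: "(tensor_shift ^^ q) g = (shift_snd ^^ q) g" if "g \<in> strip r" for g :: "nat \<times> nat \<Rightarrow> 'a"
    using that r_le_q
    by (auto simp: fun_eq_iff tensor_shift_funpow_prime_power[OF prime char q] shift_snd_funpow strip_def)
  have "(tensor_shift ^^ (q * c)) f = (shift_snd ^^ (q * c)) f" for c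
  proof (induction c)
    case (Suc c)
    then show ?case
      using base[OF strip_shift_snd[OF assms(1)]] by (simp add: funpow_add)
  qed simp
  then show ?thesis
    using assms(2) by (auto elim: dvdE)
qed

lemma tensor_shift_surj_strip:
  fixes g :: "nat \<times> nat \<Rightarrow> 'a"
  assumes "g \<in> strip r"
  shows "\<exists>f\<in>strip r. (tensor_shift ^^ n) f = g"
proof -
  obtain f where f: "f \<in> strip r" "(tensor_shift ^^ (q * n)) f = g"
    using shift_snd_surj_strip[OF assms, of "q * n"] tensor_shift_funpow_strip by fastforce
  \<comment> \<open>\<open>q * n\<close> is a multiple of \<open>q\<close> that is at least
    \<open>n\<close>, so \<open>Z ^ n\<close> is the outer factor of the surjective
    \<open>Y ^ (q * n)\<close>.\<close>
  have "q * n = n + (q * n - n)"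
    using q_pos by simp
  then have "(tensor_shift ^^ n) ((tensor_shift ^^ (q * n - n)) f) = g"
    using f(2) by (metis comp_apply funpow_add)
  then show ?thesis
    using f(1) strip_tensor_shift by blast
qed

lemma strip_ker_eq_box: "q dvd n \<Longrightarrow> strip_ker r n = (box r n :: (nat \<times> nat \<Rightarrow> 'a) set)"
  by (auto simp: strip_ker_def box_def tensor_shift_funpow_strip)

text \<open>\<open>Z ^ k f = 0\<close> implies \<open>Y ^ n f = Z ^ n f = 0\<close>, which confines
  \<open>f\<close> to width \<open>n\<close>. This yields finite dimension.\<close>

lemma strip_ker_eq_box_ker:
  assumes "q dvd n" "k \<le> n"
  shows "strip_ker r k = (box_ker r n k :: (nat \<times> nat \<Rightarrow> 'a) set)"
proof -
  have "(shift_snd ^^ n) f = 0" if "f \<in> strip r" "(tensor_shift ^^ k) f = 0" for f :: "nat \<times> nat \<Rightarrow> 'a"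
    using that assms tensor_shift_funpow_eq_0_mono tensor_shift_funpow_strip by metis
  then show ?thesis
    by (auto simp: strip_ker_def box_ker_def box_def)
qed

lemma box_ker_eq_box:
  assumes "q dvd n" "s \<le> n"
  shows "box_ker r s n = (box r s :: (nat \<times> nat \<Rightarrow> 'a) set)"
  using assms shift_snd_funpow_eq_0_mono
  by (auto simp: box_ker_def box_def tensor_shift_funpow_strip)

lemma strip_ker_fin_dim: "fun_fin_dim (strip_ker r k :: (nat \<times> nat \<Rightarrow> 'a) set)"
  using box_ker_dim(1)[of r "q * k" k, where 'a = 'a] strip_ker_eq_box_ker[of "q * k" k] q_pos
  by simp

text \<open>Rank-nullity for \<open>Z ^ a\<close>: by surjectivity on the strip it maps the kernel
  of \<open>Z ^ (a + b)\<close> onto that of \<open>Z ^ b\<close>.\<close>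

lemma strip_ker_dim_add:
  "fun_dim (strip_ker r (a + b) :: (nat \<times> nat \<Rightarrow> 'a) set)
     = fun_dim (strip_ker r a :: (nat \<times> nat \<Rightarrow> 'a) set) + fun_dim (strip_ker r b :: (nat \<times> nat \<Rightarrow> 'a) set)"
proof -
  let ?Z = "tensor_shift ^^ a :: (nat \<times> nat \<Rightarrow> 'a) \<Rightarrow> _" and ?S = "strip_ker r :: nat \<Rightarrow> (nat \<times> nat \<Rightarrow> 'a) set"
  have iff: "f \<in> ?S (a + b) \<longleftrightarrow> f \<in> strip r \<and> ?Z f \<in> ?S b" for f
    by (auto simp: strip_ker_def strip_tensor_shift funpow_add add.commute[of a])
  have img: "?Z ` ?S (a + b) = ?S b"
  proof (intro equalityI subsetI)
    fix g assume g: "g \<in> ?S b"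
    then obtain f where "f \<in> strip r" "?Z f = g"
      using tensor_shift_surj_strip by (auto simp: strip_ker_def)
    with g show "g \<in> ?Z ` ?S (a + b)" by (auto simp: iff)
  qed (auto simp: iff)
  have ker: "{f \<in> ?S (a + b). ?Z f = 0} = ?S a"
    by (auto simp: strip_ker_def intro: tensor_shift_funpow_eq_0_mono)
  show ?thesis
    using fun_rank_nullity[OF fun_subspace_strip_ker linear_op_funpow[OF linear_op_tensor_shift, of a]
        strip_ker_fin_dim[of "a + b"]] img ker by simp
qed

text \<open>Additivity makes the dimension linear in \<open>n\<close>; the slope is found at
  \<open>n = q\<close>, where the kernel is the \<open>r \<times> q\<close> box.\<close>

lemma strip_ker_dim: "fun_dim (strip_ker r n :: (nat \<times> nat \<Rightarrow> 'a) set) = r * n"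
proof -
  let ?d = "\<lambda>n. fun_dim (strip_ker r n :: (nat \<times> nat \<Rightarrow> 'a) set)"
  have d: "?d n = ?d 1 * n" for n
  proof (induction n)
    case 0
    show ?case using strip_ker_dim_add[of 0 0] by simp
  next
    case (Suc n)
    then show ?case using strip_ker_dim_add[of 1 n] by simp
  qed
  have "?d q = r * q"
    using strip_ker_eq_box[of q] box_dim(2)[of r q] by simp
  then have "?d 1 = r"
    using d[of q] q_pos by simp
  then show ?thesis
    using d[of n] by simp
qed

lemma box_ker_dim_duality:
  assumes "q dvd s + s'" "k \<le> s + s'"
  shows "r * s' + fun_dim (box_ker r s (s + s' - k) :: (nat \<times> nat \<Rightarrow> 'a) set)
       = r * (s + s' - k) + fun_dim (box_ker r s' k :: (nat \<times> nat \<Rightarrow> 'a) set)"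
proof -
  let ?Z = "tensor_shift :: (nat \<times> nat \<Rightarrow> 'a) \<Rightarrow> _" and ?Y = "shift_snd :: (nat \<times> nat \<Rightarrow> 'a) \<Rightarrow> _"
  let ?B = "box r s' :: (nat \<times> nat \<Rightarrow> 'a) set"
    and ?K = "strip_ker r (s + s' - k) :: (nat \<times> nat \<Rightarrow> 'a) set"
  have ZY: "(?Z ^^ (s + s' - k)) ((?Z ^^ k) g) = (?Y ^^ s') ((?Y ^^ s) g)" if "g \<in> strip r" for g
  proof -
    have "(?Z ^^ (s + s' - k)) ((?Z ^^ k) g) = (?Z ^^ (s + s')) g"
      using assms(2) by (metis comp_apply funpow_add le_add_diff_inverse2)
    also have "\<dots> = (?Y ^^ (s + s')) g"
      by (rule tensor_shift_funpow_strip[OF that assms(1)])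
    also have "\<dots> = (?Y ^^ s') ((?Y ^^ s) g)"
      by (metis add.commute comp_apply funpow_add)
    finally show ?thesis .
  qed
  \<comment> \<open>Both inclusions lift an element to some \<open>g\<close> in the strip, through
    \<open>Y ^ s\<close> or through \<open>Z ^ k\<close>, and apply the other operator to
    \<open>g\<close>; \<open>ZY\<close> exchanges the two vanishing conditions. Rank-nullity on each
    side then computes one dimension twice.\<close>
  have "(?Z ^^ k) ` ?B = (?Y ^^ s) ` ?K"
  proof (intro equalityI subsetI)
    fix h assume "h \<in> (?Z ^^ k) ` ?B"
    then obtain f where f: "f \<in> strip r" "(?Y ^^ s') f = 0" "h = (?Z ^^ k) f"
      by (auto simp: box_def)
    obtain g where g: "g \<in> strip r" "(?Y ^^ s) g = f"
      using shift_snd_surj_strip[OF f(1)] by blast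
    have "(?Z ^^ k) g \<in> ?K"
      using ZY[OF g(1)] f(2) g by (simp add: strip_ker_def strip_tensor_shift)
    moreover have "h = (?Y ^^ s) ((?Z ^^ k) g)"
      unfolding f(3) g(2)[symmetric] by (rule tensor_shift_funpow_commute)
    ultimately show "h \<in> (?Y ^^ s) ` ?K" by blast
  next
    fix h assume "h \<in> (?Y ^^ s) ` ?K"
    then obtain f where f: "f \<in> strip r" "(?Z ^^ (s + s' - k)) f = 0" "h = (?Y ^^ s) f"
      by (auto simp: strip_ker_def)
    obtain g where g: "g \<in> strip r" "(?Z ^^ k) g = f"
      using tensor_shift_surj_strip[OF f(1)] by blast
    have "(?Y ^^ s) g \<in> ?B"
      using ZY[OF g(1)] f(2) g by (simp add: box_def strip_shift_snd)
    moreover have "h = (?Z ^^ k) ((?Y ^^ s) g)"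
      using f(3) g(2) by (simp add: tensor_shift_funpow_commute)
    ultimately show "h \<in> (?Z ^^ k) ` ?B" by blast
  qed
  moreover have "fun_dim ((?Z ^^ k) ` ?B) + fun_dim (box_ker r s' k :: (nat \<times> nat \<Rightarrow> 'a) set) = r * s'"
    using fun_rank_nullity[OF fun_subspace_box linear_op_funpow[OF linear_op_tensor_shift, of k]
        box_dim(1)[of r s', where 'a = 'a]] by (simp add: box_ker_def box_dim(2))
  moreover have "{f \<in> ?K. (?Y ^^ s) f = 0} = box_ker r s (s + s' - k)"
    by (auto simp: strip_ker_def box_ker_def box_def)
  then have "fun_dim ((?Y ^^ s) ` ?K) + fun_dim (box_ker r s (s + s' - k) :: (nat \<times> nat \<Rightarrow> 'a) set)
      = r * (s + s' - k)"
    using fun_rank_nullity[OF fun_subspace_strip_ker linear_op_funpow[OF linear_op_shift_snd, of s]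
        strip_ker_fin_dim[of "s + s' - k"]] by (simp add: strip_ker_dim)
  ultimately show ?thesis by simp
qed

lemma box_ker_dim_periodic:
  assumes "q dvd d"
  shows "fun_dim (box_ker r (s + d) (k + d) :: (nat \<times> nat \<Rightarrow> 'a) set)
       = r * d + fun_dim (box_ker r s k :: (nat \<times> nat \<Rightarrow> 'a) set)"
proof -
  let ?Z = "tensor_shift ^^ d :: (nat \<times> nat \<Rightarrow> 'a) \<Rightarrow> _"
    and ?B = "box_ker r (s + d) (k + d) :: (nat \<times> nat \<Rightarrow> 'a) set"
  have iff: "f \<in> ?B \<longleftrightarrow> f \<in> strip r \<and> ?Z f \<in> box_ker r s k" for f
    using tensor_shift_funpow_strip[OF _ assms, of f]
    by (auto simp: box_ker_def box_def funpow_add strip_shift_snd)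
  have "?Z ` ?B = box_ker r s k"
  proof (intro equalityI subsetI)
    fix g :: "nat \<times> nat \<Rightarrow> 'a" assume g: "g \<in> box_ker r s k"
    then obtain f where "f \<in> strip r" "?Z f = g"
      using tensor_shift_surj_strip by (auto simp: box_ker_def box_def)
    with g show "g \<in> ?Z ` ?B" by (auto simp: iff)
  qed (auto simp: iff)
  \<comment> \<open>Anything in the strip killed by \<open>Z ^ d = Y ^ d\<close> lies in
    \<open>?B\<close>, as 0 lies in the target; so the kernel is the whole
    \<open>r \<times> d\<close> box.\<close>
  moreover have "0 \<in> (box_ker r s k :: (nat \<times> nat \<Rightarrow> 'a) set)"
    using fun_subspace_box_ker by (auto simp: fun_subspace_def)
  then have "{f \<in> ?B. ?Z f = 0} = box r d"
    by (auto simp: iff box_def tensor_shift_funpow_strip[OF _ assms])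
  ultimately show ?thesis
    using fun_rank_nullity[OF fun_subspace_box_ker linear_op_funpow[OF linear_op_tensor_shift, of d]
        box_ker_dim(1)[of r "s + d" "k + d", where 'a = 'a]] by (simp add: box_dim(2))
qed

text \<open>The range of exponents that the periodicity identity misses: width \<open>s + d\<close>
  does not yet constrain the kernel of \<open>Z ^ k\<close> on the strip. It reflects that all
  blocks have size at least \<open>d\<close>.\<close>

lemma box_ker_dim_initial:
  assumes "q dvd d" "k \<le> d"
  shows "fun_dim (box_ker r (s + d) k :: (nat \<times> nat \<Rightarrow> 'a) set) = r * k"
proof -
  have "(shift_snd ^^ (s + d)) f = 0" if "f \<in> strip r" "(tensor_shift ^^ k) f = 0"
    for f :: "nat \<times> nat \<Rightarrow> 'a"
    using that assms tensor_shift_funpow_eq_0_mono[of k f d] tensor_shift_funpow_strip[of f d]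
      shift_snd_funpow_eq_0_mono[of d f "s + d"] by simp
  then have "box_ker r (s + d) k = (strip_ker r k :: (nat \<times> nat \<Rightarrow> 'a) set)"
    by (auto simp: strip_ker_def box_ker_def box_def)
  then show ?thesis
    by (simp add: strip_ker_dim)
qed

lemma box_ker_dim_1:
  assumes "r \<le> s"
  shows "fun_dim (box_ker r s 1 :: (nat \<times> nat \<Rightarrow> 'a) set) = r"
proof -
  \<comment> \<open>On the kernel of \<open>Z\<close> in the strip, \<open>f (i, j + 1) = - f (i + 1, j) - f (i + 1, j + 1)\<close>, so that
    \<open>f\<close> vanishes beyond the antidiagonal \<open>i + j = r\<close>; hence it lies in the box as soon as \<open>r \<le> s\<close>.\<close>
  have vanish: "f (i, j) = 0" if f: "f \<in> strip r" "tensor_shift f = 0" and "r \<le> i + j"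
    for f :: "nat \<times> nat \<Rightarrow> 'a" and i j
    using \<open>r \<le> i + j\<close>
  proof (induction "r - i" arbitrary: i j rule: less_induct)
    case less
    show ?case
    proof (cases "r \<le> i")
      case True
      then show ?thesis using f(1) by (simp add: strip_def)
    next
      case False
      with less.prems obtain l where l: "j = Suc l"
        by (cases j) auto
      have "f (Suc i, l) = 0" "f (Suc i, Suc l) = 0"
        using less.hyps[of "Suc i" l] less.hyps[of "Suc i" "Suc l"] less.prems False l by simp_all
      moreover have "f (Suc i, l) + f (i, Suc l) + f (Suc i, Suc l) = 0"
        using fun_cong[OF f(2), of "(i, l)"] by (simp add: tensor_shift_apply)
      ultimately show ?thesis by (simp add: l)
    qed
  qed
  have "box_ker r s 1 = (strip_ker r 1 :: (nat \<times> nat \<Rightarrow> 'a) set)"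
    using assms by (auto simp: strip_ker_def box_ker_def box_def shift_snd_funpow fun_eq_iff
        intro!: vanish)
  then show ?thesis
    by (simp add: strip_ker_dim)
qed

end

subsection \<open>Jordan block sizes\<close>

text \<open>Raising \<open>k\<close> by one increases the truncated sum by the number of entries
  above \<open>k\<close>; the multiplicity of \<open>k\<close> is a difference of two such
  counts.\<close>

lemma mset_eq_if_sum_list_min_eq:
  fixes xs ys :: "nat list"
  assumes len: "length xs = length ys"
    and eq: "\<And>k. sum_list (map (min k) xs) = sum_list (map (min k) ys)"
  shows "mset xs = mset ys"
proof (rule multiset_eqI)
  let ?gt = "\<lambda>k zs. length (filter (\<lambda>z. k < z) zs)"
  have "sum_list (map (min (Suc k)) zs) = sum_list (map (min k) zs) + ?gt k zs" for k zs
    by (induction zs) auto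
  then have gt: "?gt k xs = ?gt k ys" for k
    using eq[of k] eq[of "Suc k"] by simp
  have ge: "length (filter (\<lambda>z. k \<le> z) zs) = ?gt k zs + count (mset zs) k" for k and zs :: "nat list"
    by (induction zs) auto
  \<comment> \<open>For \<open>k = 0\<close> this is the equality of lengths: the strict counts do
    not see zero entries.\<close>
  have "length (filter (\<lambda>z. k \<le> z) xs) = length (filter (\<lambda>z. k \<le> z) ys)" for k
    using len gt[of "k - 1"] by (cases k) (simp_all add: Suc_le_eq)
  then show "count (mset xs) k = count (mset ys) k" for k
    using ge[of k xs] ge[of k ys] gt[of k] by simp
qed

lemma sum_list_min_le: "sum_list (map (min k) xs) \<le> sum_list (xs :: nat list)"
  by (induction xs) auto

lemma sum_list_min_eq_imp_le:
  "sum_list (map (min k) xs) = sum_list xs \<Longrightarrow> x \<in> set xs \<Longrightarrow> x \<le> (k :: nat)"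
proof (induction xs)
  case (Cons y xs)
  then show ?case
    using sum_list_min_le[of k xs] by (cases "y \<le> k") auto
qed simp

text \<open>A block with another eigenvalue would add its positive size to the left side only, and
  truncation never increases the right side.\<close>

lemma all_blocks_if_dim_le:
  fixes n_as :: "(nat \<times> 'a) list"
  assumes "0 \<notin> fst ` set n_as"
    and "sum_list (map fst n_as) \<le> (\<Sum>n\<leftarrow>map fst [(n, e)\<leftarrow>n_as. e = ev]. min k n)"
  shows "[(n, e)\<leftarrow>n_as. e = ev] = n_as"
  using assms
proof (induction n_as)
  case (Cons x n_as)
  have le: "(\<Sum>n\<leftarrow>map fst [(n, e)\<leftarrow>n_as. e = ev]. min k n) \<le> sum_list (map fst n_as)"
    for n_as :: "(nat \<times> 'a) list"
    by (induction n_as) auto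
  show ?case
    using Cons le[of n_as] by (cases "snd x = ev") (auto simp: case_prod_beta')
qed simp

lemma sorted_rev_map_antimono:
  fixes f :: "'b::linorder \<Rightarrow> 'c::linorder"
  assumes "\<And>x y. x \<le> y \<Longrightarrow> f y \<le> f x" "sorted xs"
  shows "sorted (rev (map f xs))"
  using assms(2) by (induction xs) (auto simp: sorted_append assms(1))

section \<open>Block sizes of the tensor product\<close>

context prime_char_strip
begin

lemma jordan_nf_tensorJ:
  fixes n_as :: "(nat \<times> 'a) list"
  assumes jnf: "jordan_nf (tensorJ r s :: 'a mat) n_as" and rs: "r \<le> s"
  shows "sum_list (map (min k) (map fst n_as)) = fun_dim (box_ker r s k :: (nat \<times> nat \<Rightarrow> 'a) set)"
    and "length n_as = r" and "sum_list (map fst n_as) = r * s"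
proof -
  have nz: "0 \<notin> fst ` set n_as" and sim: "similar_mat (tensorJ r s) (jordan_matrix n_as)"
    using jnf by (auto simp: jordan_nf_def)
  obtain n P Q where "{tensorJ r s, jordan_matrix n_as, P, Q} \<subseteq> carrier_mat n n"
    using similar_matD[OF sim] by blast
  then have "dim_row (jordan_matrix n_as) = dim_row (tensorJ r s :: 'a mat)"
    by (metis carrier_matD(1) insert_subset)
  then show total: "sum_list (map fst n_as) = r * s"
    using carrier_matD(1)[OF tensorJ_carrier[of r s, where 'a = 'a]] by simp
  have dim: "fun_dim (box_ker r s k :: (nat \<times> nat \<Rightarrow> 'a) set)
      = (\<Sum>n\<leftarrow>map fst [(n, e)\<leftarrow>n_as. e = 1]. min k n)" for k
    using box_ker_dim(2)[of r s k, where 'a = 'a] dim_gen_eigenspace[OF jnf, of 1 k] by simp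
  \<comment> \<open>A multiple of \<open>q\<close> that is at least \<open>s\<close>: this power of
    \<open>Z\<close> kills the box, so 1 is the only eigenvalue.\<close>
  have "box_ker r s (q * s) = (box r s :: (nat \<times> nat \<Rightarrow> 'a) set)"
    using q_pos by (intro box_ker_eq_box) auto
  then have "[(n, e)\<leftarrow>n_as. e = 1] = n_as"
    using dim[of "q * s"] total box_dim(2)[of r s, where 'a = 'a]
    by (intro all_blocks_if_dim_le[OF nz, where k = "q * s"]) simp
  then show sums: "sum_list (map (min k) (map fst n_as))
      = fun_dim (box_ker r s k :: (nat \<times> nat \<Rightarrow> 'a) set)" for k
    using dim[of k] by simp
  \<comment> \<open>Blocks have positive size, so truncation at 1 counts them; the kernel of
    \<open>Z\<close> has dimension \<open>r\<close>.\<close>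
  have "sum_list (map (min 1) xs) = length xs" if "0 \<notin> set xs" for xs :: "nat list"
    using that by (induction xs) auto
  from this[of "map fst n_as"] show "length n_as = r"
    using sums[of 1] box_ker_dim_1[OF rs] nz by simp
qed

lemma deviation_periodic:
  fixes n_as n_as' :: "(nat \<times> 'a) list"
  assumes jnf: "jordan_nf (tensorJ r s :: 'a mat) n_as"
    and jnf': "jordan_nf (tensorJ r (s + d) :: 'a mat) n_as'"
    and rs: "r \<le> s" and d: "q dvd d"
  shows "deviation (s + d) n_as' = deviation s n_as"
proof -
  let ?L = "map fst n_as" and ?L' = "map fst n_as'"
  have rs': "r \<le> s + d" using rs by simp
  note J = jordan_nf_tensorJ[OF jnf rs] and J' = jordan_nf_tensorJ[OF jnf' rs']
  have "mset ?L' = mset (map (\<lambda>l. l + d) ?L)"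
  proof (rule mset_eq_if_sum_list_min_eq)
    fix k
    show "sum_list (map (min k) ?L') = sum_list (map (min k) (map (\<lambda>l. l + d) ?L))"
    \<comment> \<open>Up to \<open>d\<close>, each size \<open>l + d\<close> is truncated to
      \<open>k\<close>; beyond it, each contributes \<open>d\<close> plus
      \<open>min (k - d) l\<close>.\<close>
    proof (cases "k \<le> d")
      case True
      then have "sum_list (map (min k) (map (\<lambda>l. l + d) xs)) = length xs * k" for xs
        by (induction xs) auto
      from this[of ?L] show ?thesis
        unfolding J'(1) using box_ker_dim_initial[OF d True] J(2) by simp
    next
      case False
      then obtain j where k: "k = j + d"
        by (metis add.commute le_Suc_ex nat_le_linear)
      have "sum_list (map (min k) (map (\<lambda>l. l + d) xs)) = length xs * d + sum_list (map (min j) xs)" for xs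
        by (induction xs) (auto simp: k)
      from this[of ?L] show ?thesis
        unfolding J'(1) J(1) using box_ker_dim_periodic[OF d] J(2) by (simp add: k)
    qed
  qed (simp add: J J')
  then have "sort ?L' = map (\<lambda>l. l + d) (sort ?L)"
    by (intro properties_for_sort) (auto simp: sorted_map multiset.map_comp)
  then show ?thesis
    by (simp add: deviation_def jordan_partition_def rev_map)
qed

lemma deviation_duality:
  fixes n_as n_as' :: "(nat \<times> 'a) list"
  assumes jnf: "jordan_nf (tensorJ r s :: 'a mat) n_as"
    and jnf': "jordan_nf (tensorJ r s' :: 'a mat) n_as'"
    and rs: "r \<le> s" and rs': "r \<le> s'" and dvd: "q dvd s + s'"
  shows "deviation s' n_as' = rev (map uminus (deviation s n_as))"
proof -
  let ?L = "map fst n_as" and ?L' = "map fst n_as'" and ?Q = "s + s'"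
  note J = jordan_nf_tensorJ[OF jnf rs] and J' = jordan_nf_tensorJ[OF jnf' rs']
  \<comment> \<open>\<open>Z ^ ?Q\<close> kills the box, so no block exceeds \<open>?Q\<close>, and
    the natural subtraction \<open>?Q - l\<close> is exact.\<close>
  have le: "l \<le> ?Q" if "l \<in> set ?L" for l
    using that J(1)[of ?Q] J(3) box_ker_eq_box[OF dvd, of s] box_dim(2)[of r s, where 'a = 'a]
    by (intro sum_list_min_eq_imp_le[of _ ?L]) simp_all
  have le': "l \<le> ?Q" if "l \<in> set ?L'" for l
    using that J'(1)[of ?Q] J'(3) box_ker_eq_box[OF dvd, of s'] box_dim(2)[of r s', where 'a = 'a]
    by (intro sum_list_min_eq_imp_le[of _ ?L']) simp_all
  have small: "sum_list (map (min k) ?L') = sum_list (map (min k) (map (\<lambda>l. ?Q - l) ?L))"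
    if k: "k \<le> ?Q" for k
  proof -
    \<comment> \<open>Entrywise this is
      \<open>min k (?Q - l) + l = k + min (?Q - k) l\<close>.\<close>
    have "sum_list (map (min k) (map (\<lambda>l. ?Q - l) xs)) + sum_list xs
        = length xs * k + sum_list (map (min (?Q - k)) xs)" if "\<forall>l\<in>set xs. l \<le> ?Q" for xs
      using that k by (induction xs) auto
    from this[of ?L] have "sum_list (map (min k) (map (\<lambda>l. ?Q - l) ?L)) + r * s
        = r * k + fun_dim (box_ker r s (?Q - k) :: (nat \<times> nat \<Rightarrow> 'a) set)"
      using le J(1)[of "?Q - k"] J(2,3) by simp
    moreover have "r * k + r * (?Q - k) = r * s + r * s'"
      using k by (simp flip: distrib_left)
    ultimately show ?thesis
      unfolding J'(1) using box_ker_dim_duality[OF dvd k] by linarith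
  qed
  have "mset ?L' = mset (map (\<lambda>l. ?Q - l) ?L)"
  proof (rule mset_eq_if_sum_list_min_eq)
    fix k
    show "sum_list (map (min k) ?L') = sum_list (map (min k) (map (\<lambda>l. ?Q - l) ?L))"
    proof (cases "k \<le> ?Q")
      case False
      have "min k l = min ?Q l" if "l \<in> set ?L'" for l
        using False le'[OF that] by simp
      then have L': "map (min k) ?L' = map (min ?Q) ?L'"
        by (intro map_cong refl)
      have L: "map (min k) (map (\<lambda>l. ?Q - l) ?L) = map (min ?Q) (map (\<lambda>l. ?Q - l) ?L)"
        using False by simp
      show ?thesis
        unfolding L L' by (rule small) simp
    qed (rule small)
  qed (simp add: J J')
  \<comment> \<open>\<open>l \<mapsto> ?Q - l\<close> reverses the order; the resulting
    \<open>rev\<close> cancels the one in \<open>jordan_partition\<close>.\<close>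
  then have "sort ?L' = rev (map (\<lambda>l. ?Q - l) (sort ?L))"
    by (intro properties_for_sort sorted_rev_map_antimono) (auto simp: multiset.map_comp)
  then have "deviation s' n_as' = map (\<lambda>l. int (?Q - l) - int s') (sort ?L)"
    by (simp add: deviation_def jordan_partition_def)
  also have "\<dots> = map (\<lambda>l. - (int l - int s)) (sort ?L)"
    using le by (intro map_cong) (auto simp: of_nat_diff)
  also have "\<dots> = rev (map uminus (deviation s n_as))"
    by (simp add: deviation_def jordan_partition_def rev_map)
  finally show ?thesis .
qed

end

theorem theorem4:
  fixes p m r s s' :: nat
    and n_as n_as' :: "(nat \<times> 'a::field) list"
  assumes "prime p" and "CHAR('a) = p"
    and "0 < r" and "r \<le> s" and "r \<le> s'" and "r \<le> p ^ m"
    and "jordan_nf (tensorJ r s :: 'a mat) n_as"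
    and "jordan_nf (tensorJ r s' :: 'a mat) n_as'"
  shows "([s = s'] (mod p ^ m) \<longrightarrow> deviation s n_as = deviation s' n_as')
       \<and> ([int s' = - int s] (mod int (p ^ m)) \<longrightarrow>
            deviation s' n_as' = rev (map uminus (deviation s n_as)))"
proof -
  interpret prime_char_strip "TYPE('a)" p m r "p ^ m"
    by unfold_locales (use assms in auto)
  note jnf = assms(7) and jnf' = assms(8)
  show ?thesis
  proof (intro conjI impI)
    assume cong: "[s = s'] (mod p ^ m)"
    show "deviation s n_as = deviation s' n_as'"
    \<comment> \<open>Periodicity is available for an increase of the width, so the smaller of
      \<open>s\<close> and \<open>s'\<close> serves as its base.\<close>
    proof (cases "s \<le> s'")
      case True
      then have "p ^ m dvd s' - s"
        using cong_sym[OF cong] by (simp add: cong_altdef_nat)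
      with True show ?thesis
        using deviation_periodic[OF jnf, of "s' - s" n_as'] jnf' assms(4) by simp
    next
      case False
      then have "p ^ m dvd s - s'"
        using cong by (simp add: cong_altdef_nat)
      with False show ?thesis
        using deviation_periodic[OF jnf', of "s - s'" n_as] jnf assms(5) by simp
    qed
  next
    assume "[int s' = - int s] (mod int (p ^ m))"
    then have "int (p ^ m) dvd int (s + s')"
      by (simp add: cong_iff_dvd_diff add.commute)
    then have "p ^ m dvd s + s'"
      by (simp only: int_dvd_int_iff)
    then show "deviation s' n_as' = rev (map uminus (deviation s n_as))"
      using deviation_duality[OF jnf jnf'] assms(4,5) by simp
  qed
qed

end
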